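(* No quiver in the mutation class of $E_6^{(1,1)}$ has an admissible vector.
   Context: $E_6^{(1,1)}$ is the exceptional mutation-finite quiver (in the classification of Felikson–Shapiro–Tumarkin / Derksen–Owen) given by: vertices $a,b$ with a double arrow $a\Rightarrow b$; three vertices $x_1,x_2,x_3$, each with arrows $b\to x_i$ and $x_i\to a$; and three further vertices $y_1,y_2,y_3$, with $y_i$ joined to $x_i$ by a single arrow (and no other arrows). Quivers have no loops/2-cycles; $b_{ij}$ is the number of arrows $v_i\to v_j$ (negative if reversed); mutation $\mu_k$: $b'_{ij}=-b_{ij}$ if $k\in\{i,j\}$, else $b'_{ij}=b_{ij}+\mathrm{sgn}(b_{ik})[b_{ik}b_{kj}]_+$. For a quiver $Q$ on mutable vertices $v_1,\dots,v_n$ and $\boldsymbol b\in\mathbb Z^n$, add a frozen vertex $q$ with $b_i$ arrows from $v_i$ to $q$; mutations only at mutable vertices. $\boldsymbol b$ is admissible if $\boldsymbol b\neq0$ and the resulting quiver with frozen vertex has finite mutation class. *)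

theory Defs
  imports Main
begin

text \<open>
  A quiver without loops and 2-cycles on the vertex type \<open>'v\<close> is given by its skew-symmetric
  matrix: \<open>Q u v\<close> is the number of arrows from \<open>u\<close> to \<open>v\<close>, counted negatively if the arrows
  go from \<open>v\<close> to \<open>u\<close>.
\<close>

type_synonym 'v quiver = "'v \<Rightarrow> 'v \<Rightarrow> int"

definition mutate :: "'v \<Rightarrow> 'v quiver \<Rightarrow> 'v quiver" where
  "mutate k Q = (\<lambda>i j. if i = k \<or> j = k then - Q i j
                       else Q i j + sgn (Q i k) * max 0 (Q i k * Q k j))"

text \<open>The first argument of \<open>mutation_class\<close> is the set of mutable vertices.\<close>

inductive_set mutation_class :: "'v set \<Rightarrow> 'v quiver \<Rightarrow> 'v quiver set"
  for M :: "'v set" and Q :: "'v quiver" where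
  base: "Q \<in> mutation_class M Q"
| step: "Q' \<in> mutation_class M Q \<Longrightarrow> k \<in> M \<Longrightarrow> mutate k Q' \<in> mutation_class M Q"

text \<open>The vertex \<open>None\<close> is the frozen one; there are \<open>b v\<close> arrows from \<open>Some v\<close> to it.\<close>

fun add_frozen :: "'v quiver \<Rightarrow> ('v \<Rightarrow> int) \<Rightarrow> 'v option quiver" where
  "add_frozen Q b (Some u) (Some v) = Q u v"
| "add_frozen Q b (Some u) None = b u"
| "add_frozen Q b None (Some v) = - b v"
| "add_frozen Q b None None = 0"

text \<open>
  Mutation classes consist of labelled quivers. On a finite vertex set, finiteness of the class
  does not depend on whether isomorphic quivers are identified.
\<close>

definition admissible :: "'v::finite quiver \<Rightarrow> ('v \<Rightarrow> int) \<Rightarrow> bool" where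
  "admissible Q b \<longleftrightarrow> b \<noteq> (\<lambda>_. 0) \<and> finite (mutation_class (range Some) (add_frozen Q b))"

definition quiver_iso :: "'u quiver \<Rightarrow> 'v quiver \<Rightarrow> bool" where
  "quiver_iso P Q \<longleftrightarrow> (\<exists>f. bij f \<and> (\<forall>u v. Q (f u) (f v) = P u v))"

datatype leg = L1 | L2 | L3

datatype e6_vertex = A | B | X leg | Y leg

text \<open>
  The direction of the arrow between \<open>X i\<close> and \<open>Y i\<close> is a parameter:
  it is \<open>X i \<rightarrow> Y i\<close> if \<open>out i\<close> holds and \<open>Y i \<rightarrow> X i\<close> otherwise.
\<close>

fun E6_11_arrows :: "(leg \<Rightarrow> bool) \<Rightarrow> e6_vertex \<Rightarrow> e6_vertex \<Rightarrow> nat" where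
  "E6_11_arrows out A B = 2"
| "E6_11_arrows out B (X i) = 1"
| "E6_11_arrows out (X i) A = 1"
| "E6_11_arrows out (X i) (Y j) = (if i = j \<and> out i then 1 else 0)"
| "E6_11_arrows out (Y i) (X j) = (if i = j \<and> \<not> out i then 1 else 0)"
| "E6_11_arrows out _ _ = 0"

definition E6_11 :: "(leg \<Rightarrow> bool) \<Rightarrow> e6_vertex quiver" where
  "E6_11 out = (\<lambda>u v. int (E6_11_arrows out u v) - int (E6_11_arrows out v u))"

end

theory Submission
  imports Defs
begin

text \<open>
  If the framed quiver is mutation-finite and \<open>u \<Rightarrow> v\<close> is a double arrow, then alternating
  mutations at \<open>u\<close> and \<open>v\<close> force \<open>b u = - b v \<le> 0\<close>. Since an admissible vector can be carried along
  mutations, it suffices to consider the quiver in the mutation class with arrows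
  \<open>A \<rightarrow> B \<rightarrow> Y i \<rightarrow> X i \<rightarrow> A\<close>. Mutating it at \<open>A, X 1, X 2, X 3\<close> gives the defining quiver, and
  mutating it at \<open>B, Y 1, Y 2, Y 3\<close> gives a second quiver with a double arrow \<open>A \<Rightarrow> B\<close>. The first
  double arrow yields \<open>b A \<ge> 0\<close> and \<open>b B \<ge> 0\<close>, the second one \<open>b A \<le> 0\<close> and \<open>b B \<le> 0\<close>. Once
  \<open>b A = b B = 0\<close>, the same conditions say that the positive and the negative parts of the
  \<open>b (X i)\<close> sum to zero, and likewise for the \<open>b (Y i)\<close>.
\<close>

section \<open>Mutation classes\<close>

definition skew :: "'v quiver \<Rightarrow> bool" where
  "skew Q \<longleftrightarrow> (\<forall>u v. Q u v = - Q v u)"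

lemma skewD: "skew Q \<Longrightarrow> Q u v = - Q v u"
  unfolding skew_def by blast

text \<open>Turns the mutation term into a case split on signs, which settles the identities below
  automatically.\<close>

lemma sgn_mult_max: "sgn x * max 0 (x * y) = (if x > 0 \<and> y > 0 \<or> x < 0 \<and> y < 0 then \<bar>x\<bar> * y else 0)"
  for x y :: int
proof -
  consider "x = 0" | "x > 0" | "x < 0" by linarith
  then show ?thesis
    by cases (auto simp: max_def zero_le_mult_iff mult_le_0_iff)
qed

lemma skew_mutate:
  assumes "skew Q"
  shows "skew (mutate k Q)"
  unfolding skew_def
proof (intro allI)
  fix u v
  show "mutate k Q u v = - mutate k Q v u"
    using skewD[OF assms, of u k] skewD[OF assms, of v k] skewD[OF assms, of u v]
    unfolding mutate_def sgn_mult_max by auto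
qed

lemma mutate_mutate:
  assumes "skew Q"
  shows "mutate k (mutate k Q) = Q"
proof (intro ext)
  fix u v
  show "mutate k (mutate k Q) u v = Q u v"
    using skewD[OF assms, of u k] skewD[OF assms, of v k]
    unfolding mutate_def sgn_mult_max by auto
qed

lemma mutation_class_trans:
  assumes "R \<in> mutation_class M Q" "Q \<in> mutation_class M P"
  shows "R \<in> mutation_class M P"
  using assms by induction (auto intro: mutation_class.step)

lemma skew_mutation_class:
  assumes "R \<in> mutation_class M Q" "skew Q"
  shows "skew R"
  using assms by induction (auto intro: skew_mutate)

text \<open>Mutation is an involution on skew-symmetric matrices, so each step can be
  undone.\<close>

lemma mutation_class_sym:
  assumes "R \<in> mutation_class M Q" "skew Q"
  shows "Q \<in> mutation_class M R"
  using assms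
proof induction
  case base
  show ?case by (rule mutation_class.base)
next
  case (step R k)
  have "mutate k (mutate k R) \<in> mutation_class M (mutate k R)"
    by (intro mutation_class.intros step)
  moreover have "skew R"
    using step skew_mutation_class by blast
  ultimately show ?case
    using step mutation_class_trans by (metis mutate_mutate)
qed

lemma finite_mutation_class_mutate:
  assumes "finite (mutation_class M Q)" "k \<in> M"
  shows "finite (mutation_class M (mutate k Q))"
  by (rule finite_subset[OF _ assms(1)])
     (auto intro: mutation_class_trans mutation_class.intros assms(2))

lemma mutate_pullback:
  assumes "inj f"
  shows "mutate k (\<lambda>u v. Q (f u) (f v)) = (\<lambda>u v. mutate (f k) Q (f u) (f v))"
  using assms by (auto simp: mutate_def fun_eq_iff inj_eq)

text \<open>Pulling back along \<open>f\<close> commutes with mutation, so the new class lies in the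
  image of the old one.\<close>

lemma finite_mutation_class_pullback:
  assumes "finite (mutation_class N Q)" "inj f" "f ` M \<subseteq> N"
  shows "finite (mutation_class M (\<lambda>u v. Q (f u) (f v)))"
proof -
  have "P \<in> (\<lambda>R u v. R (f u) (f v)) ` mutation_class N Q"
    if "P \<in> mutation_class M (\<lambda>u v. Q (f u) (f v))" for P
    using that
  proof induction
    case base
    show ?case using mutation_class.base by blast
  next
    case (step P k)
    then obtain R where "R \<in> mutation_class N Q" "P = (\<lambda>u v. R (f u) (f v))"
      by blast
    moreover have "f k \<in> N"
      using step assms(3) by blast
    ultimately show ?case
      using mutation_class.step[of R N Q "f k"] by (simp add: mutate_pullback[OF assms(2)])
  qed
  then show ?thesis
    using assms(1) by (meson finite_imageI finite_subset subsetI)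
qed

section \<open>Framed quivers\<close>

text \<open>The finiteness half of \<open>admissible\<close> for an arbitrary vertex type, so that
  it applies to \<open>e6_vertex\<close> directly.\<close>

definition mutation_finite_framed :: "'v quiver \<Rightarrow> ('v \<Rightarrow> int) \<Rightarrow> bool" where
  "mutation_finite_framed Q b \<longleftrightarrow> finite (mutation_class (range Some) (add_frozen Q b))"

definition mutate_vector :: "'v \<Rightarrow> 'v quiver \<Rightarrow> ('v \<Rightarrow> int) \<Rightarrow> 'v \<Rightarrow> int" where
  "mutate_vector k Q b = (\<lambda>i. if i = k then - b i else b i + sgn (Q i k) * max 0 (Q i k * b k))"

lemma mutate_add_frozen:
  assumes "skew Q"
  shows "mutate (Some k) (add_frozen Q b) = add_frozen (mutate k Q) (mutate_vector k Q b)"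
proof (intro ext)
  fix u v
  show "mutate (Some k) (add_frozen Q b) u v = add_frozen (mutate k Q) (mutate_vector k Q b) u v"
    using skewD[OF assms, of k "the v"]
    unfolding mutate_def mutate_vector_def sgn_mult_max by (cases u; cases v) auto
qed

lemma mutate_vector_nonzero:
  assumes "b \<noteq> (\<lambda>_. 0)"
  shows "mutate_vector k Q b \<noteq> (\<lambda>_. 0)"
proof
  assume *: "mutate_vector k Q b = (\<lambda>_. 0)"
  then have "b k = 0"
    by (auto simp: mutate_vector_def fun_eq_iff split: if_splits)
  with * have "b = (\<lambda>_. 0)"
    by (auto simp: mutate_vector_def fun_eq_iff split: if_splits)
  with assms show False ..
qed

lemma mutation_finite_framed_class:
  assumes "Q' \<in> mutation_class UNIV Q" "skew Q"
    and "mutation_finite_framed Q b" "b \<noteq> (\<lambda>_. 0)"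
  shows "\<exists>b'. b' \<noteq> (\<lambda>_. 0) \<and> mutation_finite_framed Q' b'"
  using assms
proof induction
  case base
  then show ?case by blast
next
  case (step R k)
  then obtain c where "c \<noteq> (\<lambda>_. 0)" "mutation_finite_framed R c"
    by blast
  moreover have "skew R"
    using step skew_mutation_class by blast
  ultimately have "mutation_finite_framed (mutate k R) (mutate_vector k R c)"
    using finite_mutation_class_mutate[of "range Some" "add_frozen R c" "Some k"]
    by (simp add: mutation_finite_framed_def mutate_add_frozen)
  then show ?case
    using mutate_vector_nonzero[OF \<open>c \<noteq> _\<close>] by blast
qed

lemma mutation_finite_framed_pullback:
  assumes "mutation_finite_framed Q b" "inj f"
  shows "mutation_finite_framed (\<lambda>u v. Q (f u) (f v)) (b \<circ> f)"
proof -
  have "add_frozen (\<lambda>u v. Q (f u) (f v)) (b \<circ> f)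
    = (\<lambda>u v. add_frozen Q b (map_option f u) (map_option f v))"
  proof (intro ext)
    fix u v
    show "add_frozen (\<lambda>u v. Q (f u) (f v)) (b \<circ> f) u v
      = add_frozen Q b (map_option f u) (map_option f v)"
      by (cases u; cases v) auto
  qed
  moreover have "finite (mutation_class (range Some)
    (\<lambda>u v. add_frozen Q b (map_option f u) (map_option f v)))"
    by (rule finite_mutation_class_pullback[OF assms(1)[unfolded mutation_finite_framed_def]
          option.inj_map[OF assms(2)]]) auto
  ultimately show ?thesis
    by (simp add: mutation_finite_framed_def)
qed

section \<open>Double arrows\<close>

text \<open>
  The sign \<open>e\<close> treats \<open>u \<Rightarrow> v\<close> and \<open>v \<Rightarrow> u\<close> at once. Mutation at \<open>u\<close> and exchange of the roles of
  \<open>u\<close> and \<open>v\<close> preserve \<open>R u w + R v w\<close> and add it to \<open>R u w\<close>.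
\<close>

lemma infinite_mutation_class_kronecker:
  assumes "R u v = 2 * e" "R v u = - 2 * e" "e = 1 \<or> e = -1"
    and "u \<in> M" "v \<in> M" "w \<notin> M"
    and "e * R u w \<le> 0" "e * (R u w + R v w) < 0"
  shows "infinite (mutation_class M R)"
proof
  assume fin: "finite (mutation_class M R)"
  have uv: "u \<noteq> v" using assms(1-3) by auto
  have growth: "\<exists>R' \<in> mutation_class M R. \<exists>x y. (x = u \<and> y = v \<or> x = v \<and> y = u) \<and>
      R' x y = 2 * e \<and> R' y x = - 2 * e \<and> e * R' x w \<le> - int n \<and> e * (R' x w + R' y w) < 0" for n
  proof (induction n)
    case 0
    have "e * R u w \<le> - int 0" using assms by simp
    then show ?case
      using assms mutation_class.base by blast
  next
    case (Suc n)
    then obtain R' x y where R': "R' \<in> mutation_class M R" and xy: "x = u \<and> y = v \<or> x = v \<and> y = u"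
      and ar: "R' x y = 2 * e" "R' y x = - 2 * e"
      and val: "e * R' x w \<le> - int n" "e * (R' x w + R' y w) < 0"
      by blast
    have "x \<in> M" and ne: "x \<noteq> y" "w \<noteq> x" "w \<noteq> y"
      using xy uv assms(4-6) by auto
    have mem: "mutate x R' \<in> mutation_class M R"
      using R' \<open>x \<in> M\<close> by (rule mutation_class.step)
    have ar': "mutate x R' y x = 2 * e" "mutate x R' x y = - 2 * e"
      using ar by (simp_all add: mutate_def)
    \<comment> \<open>Since \<open>e * R' x w \<le> 0\<close>, the entries \<open>R' y x\<close> and
      \<open>R' x w\<close> do not have opposite signs, so the full product is added.\<close>
    have vals: "mutate x R' x w = - R' x w" "mutate x R' y w = R' y w + 2 * R' x w"
      using ar val assms(3) ne by (auto simp: mutate_def)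
    have val': "e * mutate x R' y w \<le> - int (Suc n)" "e * (mutate x R' y w + mutate x R' x w) < 0"
      unfolding vals using val assms(3) by auto
    have "y = u \<and> x = v \<or> y = v \<and> x = u" using xy by blast
    with ar' val' show ?case
      by (intro bexI[OF _ mem] exI[of _ y] exI[of _ x] conjI)
  qed
  \<comment> \<open>The growing entry may sit at \<open>u\<close> or at \<open>v\<close>; the sum of
    absolute values covers both.\<close>
  have unbounded: "\<exists>R' \<in> mutation_class M R. int n \<le> \<bar>R' u w\<bar> + \<bar>R' v w\<bar>" for n
  proof -
    obtain R' x y where R': "R' \<in> mutation_class M R"
      and "x = u \<and> y = v \<or> x = v \<and> y = u" "e * R' x w \<le> - int n"
      using growth[of n] by blast
    then have "int n \<le> \<bar>R' u w\<bar> + \<bar>R' v w\<bar>"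
      using assms(3) by auto
    with R' show ?thesis by blast
  qed
  define N where "N = Max ((\<lambda>R'. \<bar>R' u w\<bar> + \<bar>R' v w\<bar>) ` mutation_class M R)"
  have "\<bar>R' u w\<bar> + \<bar>R' v w\<bar> \<le> N" if "R' \<in> mutation_class M R" for R'
    using fin that unfolding N_def by (intro Max_ge) auto
  moreover obtain R' where "R' \<in> mutation_class M R" "int (nat (N + 1)) \<le> \<bar>R' u w\<bar> + \<bar>R' v w\<bar>"
    using unbounded by blast
  ultimately show False
    by fastforce
qed

lemma double_arrow_finite:
  assumes "finite (mutation_class M R)"
    and "R u v = 2" "R v u = -2" "u \<in> M" "v \<in> M" "w \<notin> M"
  shows "R u w = - R v w \<and> 0 \<le> R v w"
proof -
  have ne: "u \<noteq> v" "w \<noteq> u" "w \<noteq> v" using assms by auto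
  note inf = infinite_mutation_class_kronecker[where w = w and M = M]
  note fin = assms(1) finite_mutation_class_mutate[OF assms(1)]
  \<comment> \<open>Here a first mutation at \<open>u\<close> reverses the double arrow and leaves
    \<open>R v w\<close> unchanged, which makes the growth lemma applicable.\<close>
  have 1: "\<not> (R u w > 0 \<and> R v w < 0)"
    using inf[of "mutate u R" v u 1] assms ne fin by (auto simp: mutate_def)
  have 2: "\<not> (R u w + R v w < 0 \<and> R u w \<le> 0)"
    using inf[of R u v 1] assms by auto
  have 3: "\<not> (R u w + R v w > 0 \<and> R v w \<ge> 0)"
    using inf[of R v u "-1"] assms by auto
  show ?thesis
    using 1 2 3 by linarith
qed

section \<open>The quiver \<open>E\<^sub>6\<^sup>(\<^sup>1\<^sup>,\<^sup>1\<^sup>)\<close>\<close>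

fun hub_arrows :: "e6_vertex \<Rightarrow> e6_vertex \<Rightarrow> nat" where
  "hub_arrows A B = 1"
| "hub_arrows B (Y i) = 1"
| "hub_arrows (Y i) (X j) = (if i = j then 1 else 0)"
| "hub_arrows (X i) A = 1"
| "hub_arrows _ _ = 0"

definition hub :: "e6_vertex quiver" where
  "hub = (\<lambda>u v. int (hub_arrows u v) - int (hub_arrows v u))"

lemma skew_E6_11: "skew (E6_11 out)"
  by (simp add: skew_def E6_11_def)

lemma skew_hub: "skew hub"
  by (simp add: skew_def hub_def)

text \<open>\<open>Y i\<close> has a single neighbour, so no path passes through it and only its
  arrow is reversed.\<close>

lemma mutate_Y_E6_11: "mutate (Y i) (E6_11 out) = E6_11 (out(i := \<not> out i))"
proof (intro ext)
  fix u v
  show "mutate (Y i) (E6_11 out) u v = E6_11 (out(i := \<not> out i)) u v"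
    by (cases u; cases v) (auto simp: mutate_def E6_11_def)
qed

lemma E6_11_mutation_class: "E6_11 out' \<in> mutation_class UNIV (E6_11 out)"
proof -
  have flip: "E6_11 (g(i := c)) \<in> mutation_class UNIV (E6_11 out)"
    if "E6_11 g \<in> mutation_class UNIV (E6_11 out)" for g i c
    using that mutation_class.step[OF that, of "Y i"] mutate_Y_E6_11[of i g]
    by (cases "g i = c") (auto simp: fun_upd_idem)
  have "out' = out(L1 := out' L1, L2 := out' L2, L3 := out' L3)"
    by (rule ext, rename_tac i, case_tac i) auto
  then show ?thesis
    using flip mutation_class.base by metis
qed

text \<open>Splits the legs too, so that simplification can evaluate every matrix entry.\<close>

lemma e6_vertex_cases:
  obtains "u = A" | "u = B" | "u = X L1" | "u = X L2" | "u = X L3" | "u = Y L1" | "u = Y L2" | "u = Y L3"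
proof (cases u)
  case (X i)
  then show thesis using that by (cases i) auto
next
  case (Y i)
  then show thesis using that by (cases i) auto
qed (use that in auto)

text \<open>Mutation at \<open>A\<close> reverses \<open>A \<rightarrow> B\<close> and creates
  \<open>X i \<rightarrow> B\<close>. Each mutation at \<open>X i\<close> then adds one arrow
  \<open>A \<rightarrow> B\<close>, taking -1 to 2, and cancels
  \<open>B \<rightarrow> Y i\<close>.\<close>

lemma mutate_hub:
  "mutate (X L3) (mutate (X L2) (mutate (X L1) (mutate A hub))) = E6_11 (\<lambda>_. True)"
proof (intro ext)
  fix u v
  show "mutate (X L3) (mutate (X L2) (mutate (X L1) (mutate A hub))) u v = E6_11 (\<lambda>_. True) u v"
    by (cases u rule: e6_vertex_cases; cases v rule: e6_vertex_cases)
       (simp_all add: mutate_def E6_11_def hub_def)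
qed

lemma hub_mutation_class: "hub \<in> mutation_class UNIV (E6_11 out)"
proof -
  have "E6_11 (\<lambda>_. True) \<in> mutation_class UNIV hub"
    unfolding mutate_hub[symmetric] by (intro mutation_class.intros UNIV_I)
  then show ?thesis
    using mutation_class_sym skew_hub E6_11_mutation_class mutation_class_trans by metis
qed

lemma mutation_finite_framed_hub_imp_zero:
  assumes "mutation_finite_framed hub b"
  shows "b = (\<lambda>_. 0)"
proof -
  define R where "R = add_frozen hub b"
  define S where "S = mutate (Some (X L3)) (mutate (Some (X L2))
    (mutate (Some (X L1)) (mutate (Some A) R)))"
  define T where "T = mutate (Some (Y L3)) (mutate (Some (Y L2))
    (mutate (Some (Y L1)) (mutate (Some B) R)))"
  have "finite (mutation_class (range Some) S)" "finite (mutation_class (range Some) T)"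
    using assms unfolding S_def T_def R_def mutation_finite_framed_def
    by (intro finite_mutation_class_mutate; simp)+
  note arrow = this[THEN double_arrow_finite, of "Some A" "Some B" None]
  have "S (Some A) (Some B) = 2" "S (Some B) (Some A) = -2"
    "T (Some A) (Some B) = 2" "T (Some B) (Some A) = -2"
    by (simp_all add: S_def T_def R_def mutate_def hub_def)
  with arrow have S: "S (Some A) None = - S (Some B) None" "0 \<le> S (Some B) None"
    and T: "T (Some A) None = - T (Some B) None" "0 \<le> T (Some B) None"
    by auto
  \<comment> \<open>The total positive part over the legs, as an explicit list sum that unfolds to
    three terms.\<close>
  define \<sigma> where "\<sigma> f = (\<Sum>i\<leftarrow>[L1, L2, L3]. max 0 (f i))" for f :: "leg \<Rightarrow> int"
  have \<sigma>_nonneg: "0 \<le> \<sigma> f" for f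
    unfolding \<sigma>_def by (rule sum_list_nonneg) auto
  have \<sigma>_le_0: "f i \<le> 0" if "\<sigma> f \<le> 0" for f i
    using that by (cases i) (simp_all add: \<sigma>_def)
  have vals:
    "S (Some A) None = - b A + \<sigma> (\<lambda>i. b (X i) + max 0 (b A))"
    "S (Some B) None = b B - max 0 (- b A) - \<sigma> (\<lambda>i. - (b (X i) + max 0 (b A)))"
    "T (Some A) None = b A + max 0 (b B) + \<sigma> (\<lambda>i. b (Y i) - max 0 (- b B))"
    "T (Some B) None = - b B - \<sigma> (\<lambda>i. - (b (Y i) - max 0 (- b B)))"
    by (simp_all add: \<sigma>_def S_def T_def R_def mutate_def hub_def)
  note bounds = \<sigma>_nonneg[of "\<lambda>i. b (X i) + max 0 (b A)"] \<sigma>_nonneg[of "\<lambda>i. - (b (X i) + max 0 (b A))"]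
    \<sigma>_nonneg[of "\<lambda>i. b (Y i) - max 0 (- b B)"] \<sigma>_nonneg[of "\<lambda>i. - (b (Y i) - max 0 (- b B))"]
  \<comment> \<open>In both \<open>S\<close> and \<open>T\<close> the entry at \<open>A\<close> is
    \<le> 0 and the entry at \<open>B\<close> is \<ge> 0; dropping the nonnegative
    \<open>\<sigma>\<close> and \<open>max\<close> terms leaves opposite bounds on
    \<open>b A\<close> and \<open>b B\<close>.\<close>
  have AB: "b A = 0" "b B = 0"
    using S T bounds unfolding vals by linarith+
  then have "\<sigma> (\<lambda>i. b (X i)) \<le> 0" "\<sigma> (\<lambda>i. - b (X i)) \<le> 0"
    "\<sigma> (\<lambda>i. b (Y i)) \<le> 0" "\<sigma> (\<lambda>i. - b (Y i)) \<le> 0"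
    using S T bounds unfolding vals by simp_all
  then have "b (X i) = 0" "b (Y i) = 0" for i
    using \<sigma>_le_0[of "\<lambda>i. b (X i)" i] \<sigma>_le_0[of "\<lambda>i. - b (X i)" i]
      \<sigma>_le_0[of "\<lambda>i. b (Y i)" i] \<sigma>_le_0[of "\<lambda>i. - b (Y i)" i] by simp_all
  with AB have "b u = 0" for u
    by (cases u) auto
  then show ?thesis by blast
qed

theorem theorem5p1:
  fixes out :: "leg \<Rightarrow> bool" and E Q :: "'v::finite quiver"
  assumes "quiver_iso (E6_11 out) E"
    and "Q \<in> mutation_class UNIV E"
  shows "\<not> (\<exists>b. admissible Q b)"
proof
  assume "\<exists>b. admissible Q b"
  then obtain b where b: "b \<noteq> (\<lambda>_. 0)" "mutation_finite_framed Q b"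
    by (auto simp: admissible_def mutation_finite_framed_def)
  obtain f where f: "bij f" "\<And>u v. E (f u) (f v) = E6_11 out u v"
    using assms(1) by (auto simp: quiver_iso_def)
  have "skew E"
    unfolding skew_def
  proof (intro allI)
    fix u v
    obtain u' v' where "u = f u'" "v = f v'"
      using f(1) by (metis bij_pointE)
    then show "E u v = - E v u"
      using f(2) skewD[OF skew_E6_11] by metis
  qed
  \<comment> \<open>Reversibility lets the vector travel from \<open>Q\<close> back to
    \<open>E\<close>, then along \<open>f\<close> to \<open>E6_11 out\<close> and on to
    \<open>hub\<close>.\<close>
  then have "E \<in> mutation_class UNIV Q" "skew Q"
    using assms(2) mutation_class_sym skew_mutation_class by blast+
  then obtain c where c: "c \<noteq> (\<lambda>_. 0)" "mutation_finite_framed E c"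
    using b mutation_finite_framed_class by blast
  have "mutation_finite_framed (E6_11 out) (c \<circ> f)"
    using mutation_finite_framed_pullback[OF c(2) bij_is_inj[OF f(1)]] by (simp add: f(2))
  moreover have "c \<circ> f \<noteq> (\<lambda>_. 0)"
    using c(1) f(1) by (metis (no_types, lifting) bij_pointE comp_apply)
  ultimately show False
    using mutation_finite_framed_class[OF hub_mutation_class skew_E6_11]
      mutation_finite_framed_hub_imp_zero by blast
qed

end
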